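(* Consider the robust remanufacturing planning model with Kullback–Leibler-distance-based ambiguity sets $\mathcal{U}_{sk}=\{\pmb p\in\Delta(\mathcal{S}): D(\pmb p\,\|\,\hat{\pmb p}(\cdot|s,k))\le\theta\}$, $(s,k)\in\mathcal{S}\times\mathcal{K}$, under the standing assumptions (T) and (R) given in the context. Let $k^\ast$ be the threshold and $\zeta_{\rm rm}(k)$ ($k<k^\ast$), $\zeta_{\rm scrap}(k)$ ($k\ge k^\ast$) the control limits of the optimal robust policy, as defined in the context. Then: (a) If $\dfrac{\beta r(0,0)}{1-\beta}-\beta c_{\rm s}\le r(s,k)-r(s,k+1)$ for all $s\in\mathcal{S}$, $k\in\mathcal{K}$, then $\zeta_{\rm rm}(k)$ is non-increasing in $k$ for $k<k^\ast$. (b) $\zeta_{\rm scrap}(k)$ is non-increasing in $k$ for $k\ge k^\ast$.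
   Context: Model. $\mathcal{S}=\{0,1,\dots,S\}$ is the set of conditions of a component (larger is worse), $\mathcal{K}=\{0,1,2,\dots\}$ is the set of cumulative numbers of completed remanufacturing activities, and $\mathcal{A}=\{0,1,2\}$ is the set of actions ($0$: continue operation, $1$: remanufacture, $2$: scrap). The one-period reward of operating is $r(s,k)=g(s,k)-e(s,k)$, where $g$ is the operational gain and $e$ the environmental (carbon) cost; $c_{\rm r}$ is the remanufacturing cost, $c_{\rm s}$ the salvage value, $\beta\in(0,1)$ the discount factor. Under action $0$ the component at $(s,k)$ moves to $(s',k)$ with probability $p(s'|s,k)$; deterioration is irreversible ($p(s'|s,k)=0$ for $s'<s$), and $S$ is absorbing under action $0$. $\Delta(\mathcal{S})$ denotes the set of probability vectors on $\mathcal{S}$. The row $\pmb p(\cdot|s,k)$ is only known to lie in an ambiguity set $\mathcal{U}_{sk}$, and the overall ambiguity set is the product $\bigotimes_{s,k}\mathcal{U}_{sk}$ (rectangularity). The value function $V$ satisfies $$V(s,k)=\max_{a\in\mathcal{A}}w(s,k;a),$$ $$w(s,k;0)=\inf_{\pmb p(\cdot|s,k)\in\mathcal{U}_{sk}}\Big\{r(s,k)+\beta\sum_{s'\in\mathcal{S}}p(s'|s,k)V(s',k)\Big\},\quad w(s,k;1)=-c_{\rm r}+\beta V(0,k+1),\quad w(s,k;2)=c_{\rm s},$$ and is the limit of robust value iteration (iterating the right-hand side starting from the zero function). The optimal robust policy is $a(s,k)\in\arg\max_{a\in\mathcal{A}}w(s,k;a)$. KL distance. $\hat{\pmb p}(\cdot|s,k)$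 is the nominal (empirical) transition distribution, $\hat{\pmb P}(\cdot|\cdot,k)=[\hat p(s'|s,k)]$ is the nominal transition matrix (subject to the same irreversibility and absorption), $D(\pmb p\|\hat{\pmb p})=\sum_{s'}p(s')\log\frac{p(s')}{\hat p(s')}$ (with $0\log 0=0$, and $D=\infty$ if $p(s')>0=\hat p(s')$ for some $s'$), and $\theta>0$ is the radius. Stochastic orders. A transition matrix $[p(i|j)]_{i,j=0,\dots,n}$ ($j$ current state, $i$ next state) is IFR if $\sum_{i=m}^n p(i|j)$ is non-decreasing in $j$ for every $m$. $\pmb P_1\succeq\pmb P_2$ means $\sum_{i=m}^n p_1(i|j)\ge\sum_{i=m}^n p_2(i|j)$ for all $j,m$. Standing assumptions. (T) For every $k\in\mathcal{K}$, $\hat{\pmb P}(\cdot|\cdot,k)$ is IFR and $\hat{\pmb P}(\cdot|\cdot,k+1)\succeq\hat{\pmb P}(\cdot|\cdot,k)$. (R) $g(s,k)$ is non-increasing in $s$ and in $k$; $e(s,k)$ is non-decreasing in $s$ and in $k$; and $\frac{r(S,0)}{1-\beta}<c_{\rm s}$. Control limits. The optimal robust policy has the following form: there are $k^\ast\in\mathcal{K}$ and $s_k\in\mathcal{S}$ ($k\in\mathcal{K}$) such that $a(s,k)=0$ for $s<s_k$; and for $s\ge s_k$, $a(s,k)=1$ if $k<k^\ast$ and $a(s,k)=2$ if $k\ge k^\ast$. One writes $\zeta_{\rm rm}(k)=s_k$ for $k<k^\ast$ and $\zeta_{\rm scrap}(k)=s_k$ for $k\ge k^\ast$.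
   Formalization: Ties in the argmax defining the optimal robust policy are assumed to be broken by one fixed strict preference order on the three actions, the same at every (s,k); with arbitrary tie-breaking the control limits need not be monotone. *)

theory Defs
  imports "HOL-Analysis.Analysis"
begin

text \<open>
  Conditions are the naturals \<open>0, \<dots>, S\<close>, where \<open>S\<close> is the field \<open>worst\<close>; functions of a
  condition are only meaningful on \<open>{..S}\<close>.  A transition kernel \<open>p\<close> is written \<open>p s k s'\<close> for
  \<open>p(s' | s, k)\<close>.
\<close>

record reman_model =
  worst :: nat
  gain :: "nat \<Rightarrow> nat \<Rightarrow> real"
  env_cost :: "nat \<Rightarrow> nat \<Rightarrow> real"
  reman_cost :: real
  salvage :: real
  discount :: real

definition reward :: "reman_model \<Rightarrow> nat \<Rightarrow> nat \<Rightarrow> real" where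
  "reward M s k = gain M s k - env_cost M s k"

definition prob_vectors :: "nat \<Rightarrow> (nat \<Rightarrow> real) set" where
  "prob_vectors n = {p. (\<forall>i\<le>n. 0 \<le> p i) \<and> (\<forall>i>n. p i = 0) \<and> (\<Sum>i\<le>n. p i) = 1}"

text \<open>In the second branch \<open>p i = 0\<close> whenever \<open>q i = 0\<close>, and such summands are \<open>0\<close>.\<close>

definition KL_dist :: "nat \<Rightarrow> (nat \<Rightarrow> real) \<Rightarrow> (nat \<Rightarrow> real) \<Rightarrow> ereal" where
  "KL_dist n p q =
     (if \<exists>i\<le>n. p i > 0 \<and> q i = 0 then \<infinity> else ereal (\<Sum>i\<le>n. p i * ln (p i / q i)))"

definition KL_ambiguity ::
  "nat \<Rightarrow> (nat \<Rightarrow> nat \<Rightarrow> nat \<Rightarrow> real) \<Rightarrow> real \<Rightarrow> nat \<Rightarrow> nat \<Rightarrow> (nat \<Rightarrow> real) set" where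
  "KL_ambiguity n ph \<theta> s k = {p \<in> prob_vectors n. KL_dist n p (ph s k) \<le> ereal \<theta>}"

definition actions :: "nat set" where
  "actions = {0, 1, 2}"

text \<open>
  \<open>U s k\<close> is the ambiguity set of the row at \<open>(s, k)\<close>; rectangularity is what makes the infimum
  separate over \<open>(s, k)\<close>.
\<close>

definition action_value ::
  "reman_model \<Rightarrow> (nat \<Rightarrow> nat \<Rightarrow> (nat \<Rightarrow> real) set) \<Rightarrow> (nat \<Rightarrow> nat \<Rightarrow> real) \<Rightarrow> nat \<Rightarrow> nat \<Rightarrow> nat \<Rightarrow> real"
  where
  "action_value M U V s k a =
     (if a = 0 then
        (INF p\<in>U s k. reward M s k + discount M * (\<Sum>s'\<le>worst M. p s' * V s' k))
      else if a = 1 then - reman_cost M + discount M * V 0 (k + 1)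
      else salvage M)"

definition robust_bellman ::
  "reman_model \<Rightarrow> (nat \<Rightarrow> nat \<Rightarrow> (nat \<Rightarrow> real) set) \<Rightarrow> (nat \<Rightarrow> nat \<Rightarrow> real) \<Rightarrow> (nat \<Rightarrow> nat \<Rightarrow> real)" where
  "robust_bellman M U V = (\<lambda>s k. Max (action_value M U V s k ` actions))"

text \<open>
  The value function is the limit of robust value iteration from zero.  For nonempty ambiguity
  sets and rewards bounded above, the limit exists and is a fixed point of \<open>robust_bellman\<close> on
  \<open>{..S}\<close>: from the first iterate on, values are bounded below by the salvage value, and the
  operator is a contraction with modulus the discount factor.
\<close>

definition value_fun ::
  "reman_model \<Rightarrow> (nat \<Rightarrow> nat \<Rightarrow> (nat \<Rightarrow> real) set) \<Rightarrow> nat \<Rightarrow> nat \<Rightarrow> real" where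
  "value_fun M U s k = lim (\<lambda>n. (robust_bellman M U ^^ n) (\<lambda>_ _. 0) s k)"

text \<open>
  Among the maximising actions, the policy picks the one of least \<open>prio\<close>.  A function that is
  injective on the actions expresses a tie-breaking preference that is the same at every
  \<open>(s, k)\<close>.
\<close>

definition optimal_action ::
  "reman_model \<Rightarrow> (nat \<Rightarrow> nat \<Rightarrow> (nat \<Rightarrow> real) set) \<Rightarrow> nat \<Rightarrow> nat \<Rightarrow> nat \<Rightarrow> bool" where
  "optimal_action M U s k a \<longleftrightarrow>
     is_arg_max (action_value M U (value_fun M U) s k) (\<lambda>b. b \<in> actions) a"

definition optimal_policy ::
  "reman_model \<Rightarrow> (nat \<Rightarrow> nat \<Rightarrow> (nat \<Rightarrow> real) set) \<Rightarrow> (nat \<Rightarrow> nat) \<Rightarrow> (nat \<Rightarrow> nat \<Rightarrow> nat) \<Rightarrow> bool" where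
  "optimal_policy M U prio a \<longleftrightarrow>
     (\<forall>s\<le>worst M. \<forall>k. is_arg_min prio (optimal_action M U s k) (a s k))"

text \<open>
  For \<open>k < kstar\<close> the limit \<open>\<zeta> k\<close> is the remanufacturing limit, for \<open>kstar \<le> k\<close> it is the
  scrapping limit.
\<close>

definition control_limits ::
  "reman_model \<Rightarrow> (nat \<Rightarrow> nat \<Rightarrow> nat) \<Rightarrow> nat \<Rightarrow> (nat \<Rightarrow> nat) \<Rightarrow> bool" where
  "control_limits M a kstar \<zeta> \<longleftrightarrow>
     (\<forall>k. \<zeta> k \<le> worst M \<and>
        (\<forall>s\<le>worst M. (s < \<zeta> k \<longrightarrow> a s k = 0) \<and>
                     (\<zeta> k \<le> s \<longrightarrow> a s k = (if k < kstar then 1 else 2))))"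

text \<open>Matrices are indexed with the current state first: \<open>P j i\<close> is \<open>p(i | j)\<close>.\<close>

definition deteriorating_matrix :: "nat \<Rightarrow> (nat \<Rightarrow> nat \<Rightarrow> real) \<Rightarrow> bool" where
  "deteriorating_matrix n P \<longleftrightarrow>
     (\<forall>s\<le>n. P s \<in> prob_vectors n \<and> (\<forall>s'<s. P s s' = 0)) \<and> P n n = 1"

definition IFR :: "nat \<Rightarrow> (nat \<Rightarrow> nat \<Rightarrow> real) \<Rightarrow> bool" where
  "IFR n P \<longleftrightarrow> (\<forall>m. mono_on {..n} (\<lambda>j. \<Sum>i=m..n. P j i))"

definition stoch_dominates :: "nat \<Rightarrow> (nat \<Rightarrow> nat \<Rightarrow> real) \<Rightarrow> (nat \<Rightarrow> nat \<Rightarrow> real) \<Rightarrow> bool" where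
  "stoch_dominates n P1 P2 \<longleftrightarrow> (\<forall>j\<le>n. \<forall>m. (\<Sum>i=m..n. P2 j i) \<le> (\<Sum>i=m..n. P1 j i))"

definition assumption_T :: "nat \<Rightarrow> (nat \<Rightarrow> nat \<Rightarrow> nat \<Rightarrow> real) \<Rightarrow> bool" where
  "assumption_T n ph \<longleftrightarrow>
     (\<forall>k. IFR n (\<lambda>s. ph s k) \<and> stoch_dominates n (\<lambda>s. ph s (k + 1)) (\<lambda>s. ph s k))"

definition assumption_R :: "reman_model \<Rightarrow> bool" where
  "assumption_R M \<longleftrightarrow>
     (\<forall>k. antimono_on {..worst M} (\<lambda>s. gain M s k)) \<and>
     (\<forall>s\<le>worst M. antimono (gain M s)) \<and>
     (\<forall>k. mono_on {..worst M} (\<lambda>s. env_cost M s k)) \<and>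
     (\<forall>s\<le>worst M. mono (env_cost M s)) \<and>
     reward M (worst M) 0 / (1 - discount M) < salvage M"

end

theory Submission
  imports Defs
begin

text \<open>
  If \<open>P\<close> is stochastically dominated by \<open>Q\<close>, an upward coupling of the two turns every \<open>p\<close> in the
  KL ball around \<open>P\<close> into a \<open>q\<close> that dominates \<open>p\<close>; by the log-sum inequality (data processing)
  \<open>q\<close> lies in the KL ball of the same radius around \<open>Q\<close>.  Hence the worst-case expectation of a
  non-increasing function decreases when the nominal row grows, and value iteration preserves
  monotonicity in \<open>s\<close> and in \<open>k\<close>.  Part (b) follows since scrapping has a constant value.  If (a)
  failed between \<open>k\<close> and \<open>k + 1\<close>, operating would be optimal at \<open>(0, k + 1)\<close>, whence
  \<open>V 0 (k + 1) \<le> r 0 0 / (1 - \<beta>)\<close>; together with \<open>V \<ge> c_s\<close> the hypothesis then makes the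
  advantage of operating over remanufacturing at least as large at \<open>k\<close> as at \<open>k + 1\<close>.
\<close>

section \<open>Expectations under probability vectors\<close>

lemma prob_vectorsD:
  assumes "p \<in> prob_vectors n"
  shows "0 \<le> p i" "(\<Sum>i\<le>n. p i) = 1"
  using assms by (cases "i \<le> n"; simp add: prob_vectors_def)+

lemma expectation_mono:
  assumes "p \<in> prob_vectors n" "\<And>i. i \<le> n \<Longrightarrow> f i \<le> g i"
  shows "(\<Sum>i\<le>n. p i * f i) \<le> (\<Sum>i\<le>n. p i * (g i :: real))"
  using assms by (intro sum_mono mult_left_mono) (auto dest: prob_vectorsD)

lemma expectation_add_const:
  assumes "p \<in> prob_vectors n"
  shows "(\<Sum>i\<le>n. p i * (f i + c)) = (\<Sum>i\<le>n. p i * f i) + (c :: real)"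
  using prob_vectorsD(2)[OF assms]
  unfolding distrib_left sum.distrib sum_distrib_right[symmetric] by simp

lemma expectation_const:
  assumes "p \<in> prob_vectors n"
  shows "(\<Sum>i\<le>n. p i * c) = (c :: real)"
  using prob_vectorsD(2)[OF assms] by (simp flip: sum_distrib_right)

section \<open>Stochastic dominance and Kullback--Leibler balls\<close>

text \<open>This is the quantile coupling: the masses of \<open>P\<close> and of \<open>Q\<close>
  are laid out as consecutive intervals of [0, 1], largest index at the bottom, and overlaps are
  measured. Dominance puts the interval of \<open>i\<close> under \<open>P\<close> below that of any
  \<open>j < i\<close> under \<open>Q\<close>, so these overlaps are empty.\<close>

lemma upward_coupling:
  fixes P Q :: "nat \<Rightarrow> real"
  assumes P: "P \<in> prob_vectors n" and Q: "Q \<in> prob_vectors n"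
    and dom: "\<And>m. (\<Sum>i=m..n. P i) \<le> (\<Sum>i=m..n. Q i)"
  obtains c :: "nat \<Rightarrow> nat \<Rightarrow> real"
  where "\<And>i j. 0 \<le> c i j" "\<And>i j. j < i \<Longrightarrow> c i j = 0"
    "\<And>i. i \<le> n \<Longrightarrow> (\<Sum>j\<le>n. c i j) = P i" "\<And>j. j \<le> n \<Longrightarrow> (\<Sum>i\<le>n. c i j) = Q j"
proof -
  define F where "F i = (\<Sum>l=i..n. P l)" for i
  define G where "G i = (\<Sum>l=i..n. Q l)" for i
  define H where "H i j = min (F i) (G j)" for i j
  \<comment> \<open>the length of the intersection of the intervals between consecutive tail values of \<open>P\<close> and \<open>Q\<close>\<close>
  define c where "c i j = H i j - H (Suc i) j - (H i (Suc j) - H (Suc i) (Suc j))" for i j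
  have F_step: "F i - F (Suc i) = P i" and G_step: "G i - G (Suc i) = Q i" if "i \<le> n" for i
    using that by (simp_all add: F_def G_def sum.atLeast_Suc_atMost)
  have F_mono: "F j \<le> F i" and G_mono: "G j \<le> G i" if "i \<le> j" for i j
    unfolding F_def G_def using that prob_vectorsD(1)[OF P] prob_vectorsD(1)[OF Q]
    by (auto intro!: sum_mono2)
  have [simp]: "F (Suc n) = 0" "G (Suc n) = 0" "F 0 = 1" "G 0 = 1"
    using prob_vectorsD(2)[OF P] prob_vectorsD(2)[OF Q] by (simp_all add: F_def G_def atLeast0AtMost)
  have F_bounds: "0 \<le> F i" "F i \<le> 1" and G_bounds: "0 \<le> G i" "G i \<le> 1" for i
    using F_mono[of 0 i] G_mono[of 0 i] prob_vectorsD(1)[OF P] prob_vectorsD(1)[OF Q]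
    by (auto simp: F_def[of i] G_def[of i] sum_nonneg)
  show thesis
  proof (rule that[of c])
    show "0 \<le> c i j" for i j
      using F_mono[of i "Suc i"] G_mono[of j "Suc j"] by (auto simp: c_def H_def min_def)
    show "c i j = 0" if "j < i" for i j
    proof -
      have "F i \<le> G (Suc j)"
        using dom[of i] G_mono[of "Suc j" i] that by (simp add: F_def G_def)
      then show ?thesis
        using F_mono[of i "Suc i"] G_mono[of j "Suc j"] by (auto simp: c_def H_def min_def)
    qed
    show "(\<Sum>j\<le>n. c i j) = P i" if "i \<le> n" for i
    proof -
      have "(\<Sum>j\<le>n. c i j) = (\<Sum>j\<le>n. (H i j - H (Suc i) j) - (H i (Suc j) - H (Suc i) (Suc j)))"
        by (simp add: c_def)
      also have "\<dots> = (H i 0 - H (Suc i) 0) - (H i (Suc n) - H (Suc i) (Suc n))"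
        by (rule sum_telescope)
      \<comment> \<open>All tails lie in [0, 1], so \<open>G 0 = 1\<close> does not truncate the
        tails of \<open>P\<close> and \<open>G (Suc n) = 0\<close> annihilates them.\<close>
      also have "\<dots> = P i"
        using F_step[OF that] F_bounds by (simp add: H_def min_absorb1 min_absorb2)
      finally show ?thesis .
    qed
    show "(\<Sum>i\<le>n. c i j) = Q j" if "j \<le> n" for j
    proof -
      have "(\<Sum>i\<le>n. c i j) = (\<Sum>i\<le>n. (H i j - H i (Suc j)) - (H (Suc i) j - H (Suc i) (Suc j)))"
        by (simp add: c_def algebra_simps)
      also have "\<dots> = (H 0 j - H 0 (Suc j)) - (H (Suc n) j - H (Suc n) (Suc j))"
        by (rule sum_telescope)
      also have "\<dots> = Q j"
        using G_step[OF that] G_bounds by (simp add: H_def min_absorb1 min_absorb2)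
      finally show ?thesis .
    qed
  qed
qed

text \<open>Follows from \<open>ln x \<le> x - 1\<close> at \<open>x = b i * R / a i\<close>, with
  \<open>R\<close> the ratio of the two totals: after summation the linear terms cancel.\<close>

lemma log_sum_inequality:
  fixes a b :: "'i \<Rightarrow> real"
  assumes "finite I" and a: "\<And>i. i \<in> I \<Longrightarrow> 0 \<le> a i" and b: "\<And>i. i \<in> I \<Longrightarrow> 0 \<le> b i"
    and ac: "\<And>i. i \<in> I \<Longrightarrow> b i = 0 \<Longrightarrow> a i = 0"
  shows "sum a I * ln (sum a I / sum b I) \<le> (\<Sum>i\<in>I. a i * ln (a i / b i))"
proof (cases "sum a I = 0")
  case True
  then have "\<forall>i\<in>I. a i = 0" using a assms(1) by (simp add: sum_nonneg_eq_0_iff)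
  then show ?thesis by simp
next
  case False
  then have A: "sum a I > 0" using a by (simp add: order_less_le sum_nonneg)
  have B: "sum b I > 0"
  proof -
    obtain i where "i \<in> I" "a i \<noteq> 0" using False by (meson sum.neutral)
    then show ?thesis using ac b assms(1) by (metis order_less_le sum_pos2)
  qed
  define R where "R = sum a I / sum b I"
  have R: "R > 0" using A B by (simp add: R_def)
  have "a i - b i * R \<le> a i * ln (a i / b i) - a i * ln R" if i: "i \<in> I" for i
  proof (cases "a i = 0")
    case True
    then show ?thesis using b[OF i] R by simp
  next
    case False
    then have pos: "a i > 0" "b i > 0" using a[OF i] b[OF i] ac[OF i] by (auto simp: order_less_le)
    have "ln (b i * R / a i) \<le> b i * R / a i - 1"
      using pos R by (intro ln_le_minus_one) simp
    moreover have "ln (b i * R / a i) = ln R - ln (a i / b i)"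
      using pos R by (simp add: ln_div ln_mult)
    ultimately have "a i * (ln R - ln (a i / b i)) \<le> a i * (b i * R / a i - 1)"
      using pos by (intro mult_left_mono) auto
    then show ?thesis using pos by (simp add: algebra_simps)
  qed
  then have "(\<Sum>i\<in>I. a i - b i * R) \<le> (\<Sum>i\<in>I. a i * ln (a i / b i) - a i * ln R)"
    by (rule sum_mono)
  moreover have "(\<Sum>i\<in>I. a i - b i * R) = 0"
    using B unfolding sum_subtractf sum_distrib_right[symmetric] by (simp add: R_def)
  ultimately show ?thesis
    by (simp add: sum_subtractf R_def flip: sum_distrib_right)
qed

text \<open>The coupling, read as a kernel from \<open>P\<close> to \<open>Q\<close>, is applied to
  \<open>p\<close>. Mass only moves up, so a non-increasing \<open>f\<close> loses expectation, and
  processing both \<open>p\<close> and \<open>P\<close> by one kernel cannot increase their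
  divergence.\<close>

lemma KL_ball_stochastic_transport:
  fixes P Q :: "nat \<Rightarrow> real"
  assumes P: "P \<in> prob_vectors n" and Q: "Q \<in> prob_vectors n"
    and dom: "\<And>m. (\<Sum>i=m..n. P i) \<le> (\<Sum>i=m..n. Q i)"
    and p: "p \<in> prob_vectors n" and KL: "KL_dist n p P \<le> ereal \<theta>"
    and f: "antimono_on {..n} f"
  obtains q where "q \<in> prob_vectors n" "KL_dist n q Q \<le> ereal \<theta>"
    "(\<Sum>j\<le>n. q j * f j) \<le> (\<Sum>i\<le>n. p i * (f i :: real))"
proof -
  obtain c where c0: "\<And>i j. 0 \<le> c i j" and up: "\<And>i j. j < i \<Longrightarrow> c i j = 0"
    and cP: "\<And>i. i \<le> n \<Longrightarrow> (\<Sum>j\<le>n. c i j) = P i" and cQ: "\<And>j. j \<le> n \<Longrightarrow> (\<Sum>i\<le>n. c i j) = Q j"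
    using upward_coupling[OF P Q dom] by metis
  note p0 = prob_vectorsD(1)[OF p] and P0 = prob_vectorsD(1)[OF P]
  have finKL: "\<not> (\<exists>i\<le>n. p i > 0 \<and> P i = 0)"
    using KL unfolding KL_dist_def by (auto split: if_splits)
  then have supp: "p i = 0" if "i \<le> n" "P i = 0" for i
    using that p0[of i] by (metis order_less_le)
  have KL_sum: "(\<Sum>i\<le>n. p i * ln (p i / P i)) \<le> \<theta>"
    using KL finKL unfolding KL_dist_def by simp
  \<comment> \<open>Joint law with first marginal \<open>p\<close> and transition probabilities
    \<open>c i j / P i\<close>. If \<open>P i = 0\<close>, division yields 0, which is correct
    because \<open>p i = 0\<close> there.\<close>
  define t where "t i j = p i / P i * c i j" for i j
  have t0: "0 \<le> t i j" for i j
    using p0 P0 c0 by (simp add: t_def)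
  have t_row: "(\<Sum>j\<le>n. t i j) = p i" if "i \<le> n" for i
    using cP[OF that] supp[OF that] unfolding t_def sum_distrib_left[symmetric] by simp
  define q where "q j = (if j \<le> n then \<Sum>i\<le>n. t i j else 0)" for j
  show thesis
  proof (rule that[of q])
    have "(\<Sum>j\<le>n. q j) = (\<Sum>j\<le>n. \<Sum>i\<le>n. t i j)"
      by (simp add: q_def)
    also have "\<dots> = (\<Sum>i\<le>n. \<Sum>j\<le>n. t i j)"
      by (rule sum.swap)
    also have "\<dots> = 1"
      using prob_vectorsD(2)[OF p] by (simp add: t_row)
    finally show "q \<in> prob_vectors n"
      using t0 by (simp add: prob_vectors_def q_def sum_nonneg)
    have q_supp: "q j = 0" if "j \<le> n" "Q j = 0" for j
    proof -
      have "\<forall>i\<in>{..n}. c i j = 0"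
        using cQ[OF that(1)] that(2) c0 by (simp add: sum_nonneg_eq_0_iff)
      then show ?thesis by (simp add: q_def t_def)
    qed
    have "(\<Sum>j\<le>n. q j * ln (q j / Q j)) \<le> (\<Sum>j\<le>n. \<Sum>i\<le>n. t i j * ln (p i / P i))"
    proof (rule sum_mono)
      fix j assume "j \<in> {..n}"
      then have j: "j \<le> n" by simp
      \<comment> \<open>Log-sum in column \<open>j\<close>, whose totals are \<open>q j\<close> and
        \<open>Q j\<close>. Wherever \<open>c i j\<close> is nonzero, \<open>t i j / c i j\<close>
        equals \<open>p i / P i\<close>, independently of \<open>j\<close>.\<close>
      have "q j * ln (q j / Q j) \<le> (\<Sum>i\<le>n. t i j * ln (t i j / c i j))"
        using log_sum_inequality[of "{..n}" "\<lambda>i. t i j" "\<lambda>i. c i j"] t0 c0 cQ[OF j] j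
        by (simp add: q_def t_def)
      also have "\<dots> = (\<Sum>i\<le>n. t i j * ln (p i / P i))"
        by (rule sum.cong) (auto simp: t_def)
      finally show "q j * ln (q j / Q j) \<le> \<dots>" .
    qed
    also have "\<dots> = (\<Sum>i\<le>n. \<Sum>j\<le>n. t i j * ln (p i / P i))"
      by (rule sum.swap)
    also have "\<dots> = (\<Sum>i\<le>n. p i * ln (p i / P i))"
      by (simp add: t_row flip: sum_distrib_right)
    also note KL_sum
    finally show "KL_dist n q Q \<le> ereal \<theta>"
      using q_supp unfolding KL_dist_def by auto
    have "(\<Sum>j\<le>n. q j * f j) = (\<Sum>j\<le>n. \<Sum>i\<le>n. t i j * f j)"
      by (simp add: q_def sum_distrib_right)
    also have "\<dots> = (\<Sum>i\<le>n. \<Sum>j\<le>n. t i j * f j)"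
      by (rule sum.swap)
    also have "\<dots> \<le> (\<Sum>i\<le>n. \<Sum>j\<le>n. t i j * f i)"
    proof (intro sum_mono)
      fix i j assume ij: "i \<in> {..n}" "j \<in> {..n}"
      show "t i j * f j \<le> t i j * f i"
      proof (cases "i \<le> j")
        case True
        then show ?thesis using monotone_onD[OF f ij] t0 by (simp add: mult_left_mono)
      next
        case False
        then show ?thesis using up[of j i] by (simp add: t_def)
      qed
    qed
    also have "\<dots> = (\<Sum>i\<le>n. p i * f i)"
      by (simp add: t_row flip: sum_distrib_right)
    finally show "(\<Sum>j\<le>n. q j * f j) \<le> (\<Sum>i\<le>n. p i * f i)" .
  qed
qed

section \<open>Robust value iteration\<close>

lemma robust_bellman_eq:
  "robust_bellman M U V s k =
     max (action_value M U V s k 0) (max (- reman_cost M + discount M * V 0 (k + 1)) (salvage M))"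
  unfolding robust_bellman_def actions_def
  by (subst image_insert, subst Max_insert)+ (simp_all add: action_value_def)

locale kl_reman_model =
  fixes M :: reman_model and ph :: "nat \<Rightarrow> nat \<Rightarrow> nat \<Rightarrow> real" and \<theta> :: real
  assumes discount_pos: "0 < discount M" and discount_less_1: "discount M < 1"
    and deteriorating: "\<And>k. deteriorating_matrix (worst M) (\<lambda>s. ph s k)"
    and radius_pos: "\<theta> > 0"
    and T: "assumption_T (worst M) ph"
    and R: "assumption_R M"
begin

abbreviation "n \<equiv> worst M"
abbreviation "\<beta> \<equiv> discount M"
abbreviation "U \<equiv> KL_ambiguity n ph \<theta>"
abbreviation "operate V s k \<equiv> action_value M U V s k 0"
abbreviation "iterate N \<equiv> (robust_bellman M U ^^ N) (\<lambda>_ _. 0)"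
abbreviation "val \<equiv> value_fun M U"

lemma nominal_prob: "s \<le> n \<Longrightarrow> ph s k \<in> prob_vectors n"
  using deteriorating unfolding deteriorating_matrix_def by blast

lemma ambiguity_prob: "p \<in> U s k \<Longrightarrow> p \<in> prob_vectors n"
  unfolding KL_ambiguity_def by simp

text \<open>The nominal row is at distance 0 from itself.\<close>

lemma ambiguity_nonempty:
  assumes "s \<le> n" shows "U s k \<noteq> {}"
proof -
  have "(\<Sum>i\<le>n. ph s k i * ln (ph s k i / ph s k i)) = 0"
    by (rule sum.neutral) auto
  then have "KL_dist n (ph s k) (ph s k) \<le> ereal \<theta>"
    using radius_pos by (auto simp: KL_dist_def)
  then show ?thesis
    using nominal_prob[OF assms] unfolding KL_ambiguity_def by blast
qed

lemma reward_mono: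
  assumes "s \<le> s'" "s' \<le> n" "k \<le> k'"
  shows "reward M s' k' \<le> reward M s k"
proof -
  have "gain M s' k' \<le> gain M s k'" "env_cost M s k' \<le> env_cost M s' k'"
    using R assms unfolding assumption_R_def monotone_on_def by auto
  moreover have "gain M s k' \<le> gain M s k" "env_cost M s k \<le> env_cost M s k'"
    using R assms unfolding assumption_R_def monotone_on_def by auto
  ultimately show ?thesis unfolding reward_def by linarith
qed

lemma nominal_dominates:
  assumes "s \<le> s'" "s' \<le> n" "k \<le> k'"
  shows "(\<Sum>i=m..n. ph s k i) \<le> (\<Sum>i=m..n. ph s' k' i)"
proof -
  have "(\<Sum>i=m..n. ph s k i) \<le> (\<Sum>i=m..n. ph s' k i)"
    using T assms unfolding assumption_T_def IFR_def monotone_on_def by auto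
  also have "\<dots> \<le> (\<Sum>i=m..n. ph s' k' i)"
    using assms(3)
    by (rule lift_Suc_mono_le[rotated])
      (use T assms(2) in \<open>auto simp: assumption_T_def stoch_dominates_def\<close>)
  finally show ?thesis .
qed

lemma operate_eq:
  "operate V s k = (INF p\<in>U s k. reward M s k + \<beta> * (\<Sum>s'\<le>n. p s' * V s' k))"
  by (simp add: action_value_def)

text \<open>A real infimum is a lower bound only if the set is bounded below. Here
  \<open>- C\<close> bounds every expectation, since \<open>V\<close> takes finitely many values at
  \<open>k\<close>.\<close>

lemma operate_le:
  assumes "p \<in> U s k"
  shows "operate V s k \<le> reward M s k + \<beta> * (\<Sum>s'\<le>n. p s' * V s' k)"
  unfolding operate_eq
proof (rule cINF_lower[OF _ assms])
  define C where "C = (\<Sum>s'\<le>n. \<bar>V s' k\<bar>)"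
  have C: "- C \<le> V i k" if "i \<le> n" for i
    using member_le_sum[of i "{..n}" "\<lambda>s'. \<bar>V s' k\<bar>"] that by (simp add: C_def)
  show "bdd_below ((\<lambda>p. reward M s k + \<beta> * (\<Sum>s'\<le>n. p s' * V s' k)) ` U s k)"
  proof (rule bdd_belowI2)
    fix p assume p: "p \<in> U s k"
    have "- C \<le> (\<Sum>s'\<le>n. p s' * V s' k)"
      using expectation_mono[OF ambiguity_prob[OF p], of "\<lambda>_. - C" "\<lambda>s'. V s' k"] C
        expectation_const[OF ambiguity_prob[OF p], of "- C"] by simp
    then show "reward M s k + \<beta> * (- C) \<le> reward M s k + \<beta> * (\<Sum>s'\<le>n. p s' * V s' k)"
      using discount_pos by (intro add_left_mono mult_left_mono) auto
  qed
qed

lemma le_operate: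
  assumes "s \<le> n" "\<And>p. p \<in> U s k \<Longrightarrow> x \<le> reward M s k + \<beta> * (\<Sum>s'\<le>n. p s' * V s' k)"
  shows "x \<le> operate V s k"
  unfolding operate_eq using assms ambiguity_nonempty by (intro cINF_greatest) auto

section \<open>Monotonicity of robust value iteration\<close>

definition decreasing :: "(nat \<Rightarrow> nat \<Rightarrow> real) \<Rightarrow> bool" where
  "decreasing V \<longleftrightarrow> (\<forall>s s' k k'. s \<le> s' \<longrightarrow> s' \<le> n \<longrightarrow> k \<le> k' \<longrightarrow> V s' k' \<le> V s k)"

lemma decreasingD: "decreasing V \<Longrightarrow> s \<le> s' \<Longrightarrow> s' \<le> n \<Longrightarrow> k \<le> k' \<Longrightarrow> V s' k' \<le> V s k"
  unfolding decreasing_def by blast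

text \<open>Each row in the ball at \<open>(s, k)\<close> is transported to a row in the ball at
  \<open>(s', k')\<close> with no larger expected continuation value. Keeping the reward gap
  explicit, rather than only its sign, serves the comparison of remanufacturing limits.\<close>

lemma operate_diff_ge:
  assumes V: "decreasing V" and le: "s \<le> s'" "s' \<le> n" "k \<le> k'"
  shows "reward M s k - reward M s' k' \<le> operate V s k - operate V s' k'"
proof -
  have s: "s \<le> n" using le by simp
  have "operate V s' k' + (reward M s k - reward M s' k') \<le> operate V s k"
  proof (rule le_operate[OF s])
    fix p assume p: "p \<in> U s k"
    have "antimono_on {..n} (\<lambda>j. V j k')"
      using decreasingD[OF V] by (auto intro!: monotone_onI)
    then obtain q where q: "q \<in> prob_vectors n" "KL_dist n q (ph s' k') \<le> ereal \<theta>"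
      "(\<Sum>j\<le>n. q j * V j k') \<le> (\<Sum>i\<le>n. p i * V i k')"
      using KL_ball_stochastic_transport[OF nominal_prob[OF s] nominal_prob[OF le(2)]
          nominal_dominates[OF le] ambiguity_prob[OF p]] p
      unfolding KL_ambiguity_def by blast
    note q(3)
    also have "(\<Sum>i\<le>n. p i * V i k') \<le> (\<Sum>i\<le>n. p i * V i k)"
      using decreasingD[OF V] le(3) by (intro expectation_mono[OF ambiguity_prob[OF p]]) auto
    finally have "\<beta> * (\<Sum>j\<le>n. q j * V j k') \<le> \<beta> * (\<Sum>i\<le>n. p i * V i k)"
      using discount_pos by (simp add: mult_left_mono)
    moreover have "operate V s' k' \<le> reward M s' k' + \<beta> * (\<Sum>j\<le>n. q j * V j k')"
      using q by (intro operate_le) (simp add: KL_ambiguity_def)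
    ultimately show "operate V s' k' + (reward M s k - reward M s' k')
        \<le> reward M s k + \<beta> * (\<Sum>i\<le>n. p i * V i k)"
      by linarith
  qed
  then show ?thesis by linarith
qed

lemma operate_mono:
  assumes "decreasing V" "s \<le> s'" "s' \<le> n" "k \<le> k'"
  shows "operate V s' k' \<le> operate V s k"
  using operate_diff_ge[OF assms] reward_mono[OF assms(2-)] by linarith

lemma bellman_decreasing:
  assumes V: "decreasing V" shows "decreasing (robust_bellman M U V)"
  unfolding decreasing_def
proof (intro allI impI)
  fix s s' k k' assume le: "s \<le> s'" "s' \<le> n" "k \<le> (k' :: nat)"
  have "\<beta> * V 0 (k' + 1) \<le> \<beta> * V 0 (k + 1)"
    using decreasingD[OF V, of 0 0] le(3) discount_pos by (simp add: mult_left_mono)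
  then show "robust_bellman M U V s' k' \<le> robust_bellman M U V s k"
    unfolding robust_bellman_eq by (intro max.mono operate_mono[OF V le]) auto
qed

lemma iterate_decreasing: "decreasing (iterate N)"
proof (induction N)
  case 0
  then show ?case by (simp add: decreasing_def)
next
  case (Suc N)
  then show ?case by (simp add: bellman_decreasing)
qed

section \<open>Contraction and convergence of value iteration\<close>

lemma operate_diff_le:
  assumes "s \<le> n" and close: "\<And>s k. s \<le> n \<Longrightarrow> \<bar>V s k - W s k\<bar> \<le> e"
  shows "operate V s k - operate W s k \<le> \<beta> * e"
proof -
  have "operate V s k - \<beta> * e \<le> operate W s k"
  proof (rule le_operate[OF assms(1)])
    fix p assume p: "p \<in> U s k"
    have "V i k \<le> W i k + e" if "i \<le> n" for i
      using close[OF that, of k] by linarith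
    then have "(\<Sum>i\<le>n. p i * V i k) \<le> (\<Sum>i\<le>n. p i * (W i k + e))"
      by (intro expectation_mono[OF ambiguity_prob[OF p]])
    \<comment> \<open>Total mass 1 lets the shift by \<open>e\<close> leave the expectation
      unchanged.\<close>
    then have "\<beta> * (\<Sum>i\<le>n. p i * V i k) \<le> \<beta> * ((\<Sum>i\<le>n. p i * W i k) + e)"
      unfolding expectation_add_const[OF ambiguity_prob[OF p]]
      using discount_pos by (simp add: mult_left_mono)
    then show "operate V s k - \<beta> * e \<le> reward M s k + \<beta> * (\<Sum>i\<le>n. p i * W i k)"
      using operate_le[OF p, of V] by (simp add: distrib_left)
  qed
  then show ?thesis by linarith
qed

text \<open>A maximum changes by at most the largest change of its arguments. Scrapping contributes
  change 0, hence the need for \<open>0 \<le> \<beta> * e\<close>.\<close>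

lemma bellman_contraction:
  assumes "s \<le> n" and close: "\<And>s k. s \<le> n \<Longrightarrow> \<bar>V s k - W s k\<bar> \<le> e"
  shows "\<bar>robust_bellman M U V s k - robust_bellman M U W s k\<bar> \<le> \<beta> * e"
proof -
  have "0 \<le> e" using close[of 0 0] by simp
  then have "0 \<le> \<beta> * e" using discount_pos by simp
  moreover have "\<bar>operate V s k - operate W s k\<bar> \<le> \<beta> * e"
    using operate_diff_le[OF assms] operate_diff_le[where V = W and W = V and s = s and e = e] assms
    by (simp add: abs_le_iff abs_minus_commute)
  moreover have "\<bar>\<beta> * V 0 (k + 1) - \<beta> * W 0 (k + 1)\<bar> \<le> \<beta> * e"
    using close[of 0 "k + 1"] discount_pos
    by (simp add: abs_mult mult_left_mono flip: right_diff_distrib)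
  ultimately show ?thesis
    unfolding robust_bellman_eq by (simp add: max_def abs_le_iff)
qed

lemma iterate_step:
  obtains D where "\<And>N s k. s \<le> n \<Longrightarrow> \<bar>iterate (Suc N) s k - iterate N s k\<bar> \<le> D * \<beta> ^ N"
proof -
  \<comment> \<open>Bounds the first iterate uniformly in \<open>(s, k)\<close>: rewards may be
    unbounded below in \<open>k\<close>, but they are at most \<open>reward M 0 0\<close>, and the
    scrap option is a floor.\<close>
  define D where "D = \<bar>reward M 0 0\<bar> + \<bar>reman_cost M\<bar> + \<bar>salvage M\<bar>"
  have "\<bar>iterate (Suc N) s k - iterate N s k\<bar> \<le> D * \<beta> ^ N" if "s \<le> n" for N s k
    using that
  proof (induction N arbitrary: s k)
    case 0
    have "operate (\<lambda>_ _. 0) s k = reward M s k"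
      unfolding operate_eq using ambiguity_nonempty[OF 0] by simp
    then show ?case
      using reward_mono[OF _ 0, of 0 0 k] by (auto simp: robust_bellman_eq D_def max_def)
  next
    case (Suc N)
    show ?case
      using bellman_contraction[OF Suc.prems Suc.IH] by (simp add: mult.left_commute)
  qed
  then show thesis by (rule that)
qed

text \<open>Geometric increments are summable. The error bound is uniform in \<open>(s, k)\<close>,
  as the contraction requires when it is applied to iterate and limit.\<close>

lemma value_iteration_limit:
  obtains D where "\<And>s k. s \<le> n \<Longrightarrow> (\<lambda>N. iterate N s k) \<longlonglongrightarrow> val s k"
    and "\<And>N s k. s \<le> n \<Longrightarrow> \<bar>iterate N s k - val s k\<bar> \<le> D * \<beta> ^ N"
proof -
  obtain D where D: "\<And>N s k. s \<le> n \<Longrightarrow> \<bar>iterate (Suc N) s k - iterate N s k\<bar> \<le> D * \<beta> ^ N"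
    using iterate_step by blast
  have geo: "summable (\<lambda>N. D * \<beta> ^ N)"
    using discount_pos discount_less_1 by (intro summable_mult summable_geometric) simp
  have lim: "(\<lambda>N. iterate N s k) \<longlonglongrightarrow> val s k" if "s \<le> n" for s k
  proof -
    have "summable (\<lambda>N. iterate (Suc N) s k - iterate N s k)"
      by (rule summable_comparison_test'[OF geo]) (use D[OF that] in simp)
    then have "convergent (\<lambda>m. iterate m s k - iterate 0 s k)"
      unfolding summable_iff_convergent sum_lessThan_telescope[of "\<lambda>N. iterate N s k"] .
    then have "convergent (\<lambda>m. iterate m s k)"
      using convergent_diff_const_right_iff by blast
    then show ?thesis
      unfolding value_fun_def by (simp add: convergent_LIMSEQ_iff)
  qed
  have "\<bar>iterate N s k - val s k\<bar> \<le> D / (1 - \<beta>) * \<beta> ^ N" if s: "s \<le> n" for N s k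
  proof (rule LIMSEQ_le_const2)
    show "(\<lambda>m. \<bar>iterate N s k - iterate (m + N) s k\<bar>) \<longlonglongrightarrow> \<bar>iterate N s k - val s k\<bar>"
      using LIMSEQ_ignore_initial_segment[OF lim[OF s]] by (intro tendsto_intros)
    \<comment> \<open>The partial geometric sum in closed form: passing from \<open>m\<close> to
      \<open>Suc m\<close> adds exactly \<open>D * \<beta> ^ (m + N)\<close>.\<close>
    have "\<bar>iterate N s k - iterate (m + N) s k\<bar> \<le> D / (1 - \<beta>) * (\<beta> ^ N - \<beta> ^ (m + N))" for m
    proof (induction m)
      case (Suc m)
      have "D / (1 - \<beta>) * (\<beta> ^ (m + N) - \<beta> ^ (Suc m + N)) = D * \<beta> ^ (m + N)"
        using discount_less_1 by (simp add: field_simps)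
      then show ?case
        using Suc D[OF s, of "m + N" k] by (simp add: right_diff_distrib)
    qed simp
    moreover have "D / (1 - \<beta>) * (\<beta> ^ N - \<beta> ^ (m + N)) \<le> D / (1 - \<beta>) * \<beta> ^ N" for m
      using D[of 0 0 0] discount_pos discount_less_1 by (intro mult_left_mono) simp_all
    ultimately have "\<bar>iterate N s k - iterate (m + N) s k\<bar> \<le> D / (1 - \<beta>) * \<beta> ^ N" for m
      using order_trans by blast
    then show "\<exists>m0. \<forall>m\<ge>m0. \<bar>iterate N s k - iterate (m + N) s k\<bar> \<le> D / (1 - \<beta>) * \<beta> ^ N"
      by blast
  qed
  with lim show thesis by (rule that)
qed

lemma value_decreasing: "decreasing val"
  unfolding decreasing_def
proof (intro allI impI)
  fix s s' k k' assume le: "s \<le> s'" "s' \<le> n" "k \<le> (k' :: nat)"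
  have lim: "\<And>s k. s \<le> n \<Longrightarrow> (\<lambda>N. iterate N s k) \<longlonglongrightarrow> val s k"
    using value_iteration_limit by blast
  show "val s' k' \<le> val s k"
    using lim[of s' k'] lim[of s k] le decreasingD[OF iterate_decreasing le]
    by (intro LIMSEQ_le) auto
qed

text \<open>The shifted iterates tend to \<open>val\<close>, and by contraction also to the Bellman
  image of \<open>val\<close>; limits are unique.\<close>

lemma value_fixed_point:
  assumes s: "s \<le> n" shows "robust_bellman M U val s k = val s k"
proof -
  obtain D where lim: "\<And>s k. s \<le> n \<Longrightarrow> (\<lambda>N. iterate N s k) \<longlonglongrightarrow> val s k"
    and dist: "\<And>N s k. s \<le> n \<Longrightarrow> \<bar>iterate N s k - val s k\<bar> \<le> D * \<beta> ^ N"
    using value_iteration_limit by blast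
  have "(\<lambda>N. iterate (Suc N) s k - robust_bellman M U val s k) \<longlonglongrightarrow> 0"
  proof (rule Lim_null_comparison)
    show "\<forall>\<^sub>F N in sequentially.
        norm (iterate (Suc N) s k - robust_bellman M U val s k) \<le> \<beta> * (D * \<beta> ^ N)"
      using bellman_contraction[OF s dist] by simp
    show "(\<lambda>N. \<beta> * (D * \<beta> ^ N)) \<longlonglongrightarrow> 0"
      using discount_pos discount_less_1
      by (intro tendsto_mult_right_zero LIMSEQ_power_zero) simp
  qed
  moreover have "(\<lambda>N. iterate (Suc N) s k - robust_bellman M U val s k)
      \<longlonglongrightarrow> val s k - robust_bellman M U val s k"
    using LIMSEQ_Suc[OF lim[OF s]] by (intro tendsto_diff) auto
  ultimately show ?thesis
    using LIMSEQ_unique by fastforce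
qed

lemma salvage_le_value: "s \<le> n \<Longrightarrow> salvage M \<le> val s k"
  using value_fixed_point[of s k] by (simp add: robust_bellman_eq)

section \<open>Control limits\<close>

lemma optimal_action_value:
  assumes "s \<le> n" "optimal_action M U s k b"
  shows "action_value M U val s k b = val s k"
proof -
  have "Max (action_value M U val s k ` actions) = action_value M U val s k b"
    using assms(2) unfolding optimal_action_def is_arg_max_linorder
    by (intro Max_eqI) (auto simp: actions_def)
  then show ?thesis
    using value_fixed_point[OF assms(1), of k] by (simp add: robust_bellman_def)
qed

text \<open>From condition 0 every successor value is at most \<open>val 0 k\<close>, so operating
  gives \<open>val 0 k \<le> reward M 0 0 + \<beta> * val 0 k\<close>. One row of the ball suffices,
  because operating takes an infimum.\<close>

lemma value_bound_if_operating:
  assumes "optimal_action M U 0 k 0"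
  shows "val 0 k \<le> reward M 0 0 / (1 - \<beta>)"
proof -
  obtain p where p: "p \<in> U 0 k" using ambiguity_nonempty[of 0 k] by auto
  have "(\<Sum>i\<le>n. p i * val i k) \<le> (\<Sum>i\<le>n. p i * val 0 k)"
    using decreasingD[OF value_decreasing]
    by (intro expectation_mono[OF ambiguity_prob[OF p]]) auto
  then have "\<beta> * (\<Sum>i\<le>n. p i * val i k) \<le> \<beta> * val 0 k"
    using expectation_const[OF ambiguity_prob[OF p]] discount_pos by (simp add: mult_left_mono)
  then have "val 0 k \<le> reward M 0 0 + \<beta> * val 0 k"
    using operate_le[OF p, of val] optimal_action_value[OF _ assms] reward_mono[of 0 0 0 k]
    by linarith
  then show ?thesis
    using discount_less_1 by (simp add: field_simps)
qed

end

theorem theorem2: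
  fixes M :: reman_model
    and ph :: "nat \<Rightarrow> nat \<Rightarrow> nat \<Rightarrow> real"
    and \<theta> :: real
    and U :: "nat \<Rightarrow> nat \<Rightarrow> (nat \<Rightarrow> real) set"
    and prio :: "nat \<Rightarrow> nat"
    and a :: "nat \<Rightarrow> nat \<Rightarrow> nat"
    and kstar :: nat
    and \<zeta> :: "nat \<Rightarrow> nat"
  assumes "0 < discount M" and "discount M < 1"
    and "\<And>k. deteriorating_matrix (worst M) (\<lambda>s. ph s k)"
    and "\<theta> > 0"
    and "U = KL_ambiguity (worst M) ph \<theta>"
    and "assumption_T (worst M) ph"
    and "assumption_R M"
    and "inj_on prio actions"
    and "optimal_policy M U prio a"
    and "control_limits M a kstar \<zeta>"
  shows "((\<forall>s\<le>worst M. \<forall>k.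
            discount M * reward M 0 0 / (1 - discount M) - discount M * salvage M
              \<le> reward M s k - reward M s (k + 1))
          \<longrightarrow> antimono_on {..<kstar} \<zeta>)
         \<and> antimono_on {kstar..} \<zeta>"
proof -
  interpret kl_reman_model M ph \<theta>
    using assms by unfold_locales auto
  note U_eq = \<open>U = KL_ambiguity (worst M) ph \<theta>\<close>
  define w where "w = action_value M U (value_fun M U)"
  have policy: "b \<in> actions \<Longrightarrow> w s k b \<le> w s k (a s k)"
    "b \<in> actions \<Longrightarrow> w s k b = w s k (a s k) \<Longrightarrow> prio (a s k) \<le> prio b"
    if "s \<le> worst M" for s k b
    using \<open>optimal_policy M U prio a\<close> that
    unfolding optimal_policy_def optimal_action_def is_arg_min_linorder is_arg_max_linorder w_def
    by (auto simp: U_eq)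
  have opt: "optimal_action M U s k (a s k)" if "s \<le> worst M" for s k
    using \<open>optimal_policy M U prio a\<close> that unfolding optimal_policy_def is_arg_min_def by blast
  have limits: "\<zeta> k \<le> worst M" "s \<le> worst M \<Longrightarrow> s < \<zeta> k \<Longrightarrow> a s k = 0"
    "s \<le> worst M \<Longrightarrow> \<zeta> k \<le> s \<Longrightarrow> a s k = (if k < kstar then 1 else 2)" for s k
    using \<open>control_limits M a kstar \<zeta>\<close> unfolding control_limits_def by blast+
  \<comment> \<open>A tie at both \<open>k\<close> and \<open>k'\<close> would be resolved in the same way at both.\<close>
  have limit_le: "\<zeta> k' \<le> \<zeta> k"
    if b: "b \<in> {1, 2}" "a (\<zeta> k) k = b"
      and adv: "\<zeta> k < \<zeta> k' \<Longrightarrow> w (\<zeta> k) k' 0 - w (\<zeta> k) k' b \<le> w (\<zeta> k) k 0 - w (\<zeta> k) k b"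
    for k k' b
  proof (rule ccontr)
    assume "\<not> \<zeta> k' \<le> \<zeta> k"
    then have less: "\<zeta> k < \<zeta> k'" by simp
    let ?s = "\<zeta> k"
    have s: "?s \<le> worst M" by (rule limits(1))
    have a0: "a ?s k' = 0" using limits(2)[OF s less] .
    have acts: "0 \<in> actions" "b \<in> actions" using b by (auto simp: actions_def)
    have "w ?s k 0 \<le> w ?s k b" "w ?s k' b \<le> w ?s k' 0"
      using policy(1)[OF s acts(1), of k] policy(1)[OF s acts(2), of k'] b a0 by auto
    \<comment> \<open>The advantage of operating over \<open>b\<close> is at most 0 at
      \<open>k\<close>, at least 0 at \<open>k'\<close>, and no larger at \<open>k'\<close> than at
      \<open>k\<close>; so it vanishes at both.\<close>
    then have "w ?s k 0 = w ?s k b" "w ?s k' b = w ?s k' 0"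
      using adv[OF less] by auto
    then have "prio b \<le> prio 0" "prio 0 \<le> prio b"
      using policy(2)[OF s acts(1), of k] policy(2)[OF s acts(2), of k'] b a0 by auto
    then have "b = 0" using \<open>inj_on prio actions\<close> acts by (auto dest: inj_onD)
    then show False using b by simp
  qed
  have "antimono_on {kstar..} \<zeta>"
  proof (rule monotone_onI)
    fix k k' assume k: "k \<in> {kstar..}" "k' \<in> {kstar..}" "k \<le> k'"
    \<comment> \<open>The scrap value does not depend on \<open>k\<close>, so only the values of
      operating need comparing.\<close>
    have "w (\<zeta> k) k' 0 \<le> w (\<zeta> k) k 0"
      unfolding w_def U_eq by (rule operate_mono[OF value_decreasing order_refl limits(1) k(3)])
    moreover have "w s j 2 = salvage M" for s j
      by (simp add: w_def action_value_def)
    ultimately show "\<zeta> k' \<le> \<zeta> k"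
      using k limits(3)[OF limits(1) order_refl, of k] by (intro limit_le[of 2]) auto
  qed
  moreover have "antimono_on {..<kstar} \<zeta>"
    if gap: "\<forall>s\<le>worst M. \<forall>k. discount M * reward M 0 0 / (1 - discount M) - discount M * salvage M
              \<le> reward M s k - reward M s (k + 1)"
  proof -
    have step: "\<zeta> (Suc k) \<le> \<zeta> k" if k: "Suc k < kstar" for k
    proof (rule limit_le[of 1])
      show "a (\<zeta> k) k = 1"
        using k limits(3)[OF limits(1) order_refl, of k] by simp
      assume "\<zeta> k < \<zeta> (Suc k)"
      \<comment> \<open>The assumed violation forces \<open>\<zeta> (Suc k) > 0\<close>, so
        condition 0 lies strictly below this limit.\<close>
      then have "a 0 (Suc k) = 0" by (intro limits(2)) auto
      then have "value_fun M U 0 (Suc k) \<le> reward M 0 0 / (1 - discount M)"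
        using value_bound_if_operating opt[of 0 "Suc k"] U_eq by simp
      moreover have "salvage M \<le> value_fun M U 0 (Suc (Suc k))"
        using salvage_le_value U_eq by simp
      \<comment> \<open>The left side is the drop in remanufacturing value from \<open>k\<close> to
        \<open>Suc k\<close>, the cost cancelling. It is shown to be at most the drop in the value
        of operating.\<close>
      ultimately have "discount M * value_fun M U 0 (Suc k) - discount M * value_fun M U 0 (Suc (Suc k))
          \<le> discount M * (reward M 0 0 / (1 - discount M)) - discount M * salvage M"
        using discount_pos by (intro diff_mono mult_left_mono) auto
      also have "\<dots> \<le> reward M (\<zeta> k) k - reward M (\<zeta> k) (Suc k)"
        using gap limits(1) by simp
      also have "\<dots> \<le> w (\<zeta> k) k 0 - w (\<zeta> k) (Suc k) 0"
        unfolding w_def U_eq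
        by (rule operate_diff_ge[OF value_decreasing order_refl limits(1)]) simp
      finally show "w (\<zeta> k) (Suc k) 0 - w (\<zeta> k) (Suc k) 1 \<le> w (\<zeta> k) k 0 - w (\<zeta> k) k 1"
        by (simp add: w_def action_value_def)
    qed simp
    have chain: "\<zeta> (k + d) \<le> \<zeta> k" if "k + d < kstar" for k d
      using that
    proof (induction d)
      case (Suc d)
      then show ?case using step[of "k + d"] by simp
    qed simp
    show ?thesis
    proof (rule monotone_onI)
      fix k k' assume "k \<in> {..<kstar}" "k' \<in> {..<kstar}" "k \<le> k'"
      then show "\<zeta> k' \<le> \<zeta> k" using chain[of k "k' - k"] by simp
    qed
  qed
  ultimately show ?thesis by blast
qed

end
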